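(* Let $A$ be a two-level strength-$3$ design with $N$ runs (on any number $n$ of factors) satisfying $J_5\equiv J_7\equiv 0$. If $A$ has any nonzero odd-order $J$-characteristic, i.e. $j(s)\ne 0$ for some $s\subseteq[n]$ with $|s|$ odd, then $$N\ \ge\ 2^{\,q-1}\ \ge\ 2^{8}=256,$$ where $q$ is the smallest odd order with a nonzero characteristic, i.e. the least odd integer for which there is $s\subseteq[n]$ with $|s|=q$ and $j(s)\neq 0$. Consequently, for every $N<256$ (in particular for $N\in\{56,64\}$), no two-level strength-$3$ design with $N$ runs satisfying $J_5\equiv J_7\equiv 0$ and having a nonzero odd-order $J$-characteristic exists, for any number of factors.
   Context: $[n]=\{1,2,\dots,n\}$. A two-level design with $N$ runs on $n$ factors is a multiset of $N$ elements (runs) $r=(r_1,\dots,r_n)\in\{-1,+1\}^n$; equivalently, it is given by its row-multiplicity vector $f:\{-1,+1\}^n\to\mathbb Z_{\ge 0}$ with $\sum_x f(x)=N$. Its (signed) $J$-characteristics are the integers $j(s)=\sum_{\text{runs } r}\prod_{i\in s} r_i=\sum_{x\in\{-1,+1\}^n} f(x)\prod_{i\in s}x_i$ for $s\subseteq[n]$ (runs counted with multiplicity); the order of the characteristic $j(s)$ is $|s|$. For an integer $m\geq 1$, $J_m\equiv 0$ means that $j(s)=0$ for every $s\subseteq[n]$ of cardinality $m$ (vacuously true if $m>n$). The design has strength $t$ if $J_1\equiv\dots\equiv J_t\equiv 0$. *)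

theory Defs
  imports Main "HOL-Library.Multiset" "HOL-Library.FuncSet"
begin

definition runs :: "nat \<Rightarrow> (nat \<Rightarrow> int) set" where
  "runs n = {1..n} \<rightarrow>\<^sub>E {-1, 1}"

definition two_level_design :: "nat \<Rightarrow> nat \<Rightarrow> (nat \<Rightarrow> int) multiset \<Rightarrow> bool" where
  "two_level_design n N A \<longleftrightarrow> size A = N \<and> set_mset A \<subseteq> runs n"

definition J_char :: "(nat \<Rightarrow> int) multiset \<Rightarrow> nat set \<Rightarrow> int" where
  "J_char A s = (\<Sum>r\<in>#A. \<Prod>i\<in>s. r i)"

definition J_vanishes :: "nat \<Rightarrow> (nat \<Rightarrow> int) multiset \<Rightarrow> nat \<Rightarrow> bool" where
  "J_vanishes n A m \<longleftrightarrow> (\<forall>s\<subseteq>{1..n}. card s = m \<longrightarrow> J_char A s = 0)"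

definition has_strength :: "nat \<Rightarrow> (nat \<Rightarrow> int) multiset \<Rightarrow> nat \<Rightarrow> bool" where
  "has_strength n A t \<longleftrightarrow> (\<forall>m\<in>{1..t}. J_vanishes n A m)"

definition has_nonzero_odd_J :: "nat \<Rightarrow> (nat \<Rightarrow> int) multiset \<Rightarrow> bool" where
  "has_nonzero_odd_J n A \<longleftrightarrow> (\<exists>s\<subseteq>{1..n}. odd (card s) \<and> J_char A s \<noteq> 0)"

text \<open>Meaningful only if \<open>has_nonzero_odd_J n A\<close>; otherwise the value is unspecified.\<close>

definition min_odd_order :: "nat \<Rightarrow> (nat \<Rightarrow> int) multiset \<Rightarrow> nat" where
  "min_odd_order n A = (LEAST q. odd q \<and> (\<exists>s\<subseteq>{1..n}. card s = q \<and> J_char A s \<noteq> 0))"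

end

theory Submission
  imports Defs
begin

text \<open>
  Let \<open>s\<close> carry a nonzero characteristic of smallest odd order \<open>q\<close>. Comparing the expansions of
  \<open>\<Prod>i\<in>s. 1 + r i\<close> and \<open>\<Prod>i\<in>s. 1 - r i\<close>, summed over the runs, only \<open>j(s)\<close> survives in the
  difference, which therefore equals \<open>2 * j(s)\<close>. All factors \<open>1 + r i\<close> and \<open>1 - r i\<close> are even,
  so \<open>2 ^ (q - 1)\<close> divides \<open>j(s)\<close>, while the absolute value of \<open>j(s)\<close> is at most \<open>N\<close>.
\<close>

text \<open>Multiplying out the product gives one monomial per subset \<open>t\<close> of
  \<open>s\<close>, and summing that monomial over the runs yields
  \<open>J_char A t\<close>.\<close>

lemma sum_J_char_Pow:
  assumes "finite s"
  shows "(\<Sum>t\<in>Pow s. J_char A t) = (\<Sum>r\<in>#A. \<Prod>i\<in>s. 1 + r i)"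
proof (induction A)
  case (add r A)
  have "(\<Prod>i\<in>s. 1 + r i) = (\<Sum>t\<in>Pow s. \<Prod>i\<in>t. r i)"
    by (subst add.commute) (simp add: prod_add[OF assms])
  with add show ?case by (simp add: J_char_def sum.distrib)
qed (simp add: J_char_def)

text \<open>Passing from \<open>r i\<close> to \<open>- r i\<close> in the expansion scales the
  monomial of \<open>t\<close> by \<open>(-1) ^ card t\<close>, so the parity of the order becomes
  visible.\<close>

lemma sum_signed_J_char_Pow:
  assumes "finite s"
  shows "(\<Sum>t\<in>Pow s. (-1) ^ card t * J_char A t) = (\<Sum>r\<in>#A. \<Prod>i\<in>s. 1 - r i)"
proof (induction A)
  case (add r A)
  have "(\<Prod>i\<in>s. 1 - r i) = (\<Sum>t\<in>Pow s. (-1) ^ card t * (\<Prod>i\<in>t. r i))"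
    by (simp add: prod_diff_conv_sum[OF assms])
  with add show ?case by (simp add: J_char_def sum.distrib distrib_left)
qed (simp add: J_char_def)

lemma power2_dvd_prod:
  fixes f :: "'a \<Rightarrow> int"
  assumes "\<And>i. i \<in> s \<Longrightarrow> even (f i)"
  shows "2 ^ card s dvd (\<Prod>i\<in>s. f i)"
  using prod_dvd_prod[of s "\<lambda>_. 2" f] assms by simp

lemma dvd_sum_mset:
  fixes f :: "'a \<Rightarrow> 'b::comm_semiring_1"
  assumes "\<And>x. x \<in># A \<Longrightarrow> d dvd f x"
  shows "d dvd (\<Sum>x\<in>#A. f x)"
  using assms by (induction A) auto

lemma abs_run:
  assumes "two_level_design n N A" "r \<in># A" "i \<in> {1..n}"
  shows "\<bar>r i\<bar> = 1"
proof -
  have "r \<in> {1..n} \<rightarrow>\<^sub>E {-1, 1}"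
    using assms(1,2) unfolding two_level_design_def runs_def by blast
  from PiE_mem[OF this assms(3)] show ?thesis by auto
qed

lemma abs_prod_eq_1:
  fixes f :: "'a \<Rightarrow> 'b::linordered_idom"
  assumes "\<And>i. i \<in> s \<Longrightarrow> \<bar>f i\<bar> = 1"
  shows "\<bar>\<Prod>i\<in>s. f i\<bar> = 1"
  using assms by (induction s rule: infinite_finite_induct) (simp_all add: abs_mult)

text \<open>Each run, counted with multiplicity, contributes 1 or -1.\<close>

lemma abs_J_char_le:
  assumes "two_level_design n N A" "s \<subseteq> {1..n}"
  shows "\<bar>J_char A s\<bar> \<le> int N"
proof -
  have "\<bar>\<Prod>i\<in>s. r i\<bar> = 1" if "r \<in># A" for r
    using abs_run[OF assms(1) that] assms(2) by (intro abs_prod_eq_1) blast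
  then have "\<bar>J_char A s\<bar> \<le> int (size A)"
    unfolding J_char_def
  proof (induction A)
    case (add r A)
    then have "\<bar>\<Prod>i\<in>s. r i\<bar> = 1" and "\<bar>\<Sum>r\<in>#A. \<Prod>i\<in>s. r i\<bar> \<le> int (size A)" by simp_all
    then show ?case by simp
  qed simp
  with assms(1) show ?thesis by (simp add: two_level_design_def)
qed

text \<open>Minimality of the odd order enters as \<open>zero\<close>: among the subsets of
  \<open>s\<close>, only \<open>s\<close> itself may carry a nonzero odd-order
  characteristic.\<close>

lemma power2_dvd_J_char:
  assumes design: "two_level_design n N A" and s: "s \<subseteq> {1..n}" and odd: "odd (card s)"
    and zero: "\<And>t. t \<subset> s \<Longrightarrow> odd (card t) \<Longrightarrow> J_char A t = 0"
  shows "2 ^ (card s - 1) dvd J_char A s"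
proof -
  have fin: "finite s" using s by (rule finite_subset) simp
  \<comment> \<open>For even \<open>card t\<close> the two terms cancel; for odd
    \<open>card t\<close> they add up, and \<open>zero\<close> leaves only
    \<open>t = s\<close>.\<close>
  have "J_char A t - (-1) ^ card t * J_char A t = (if t = s then 2 * J_char A s else 0)"
    if "t \<in> Pow s" for t
    using that odd zero[of t] by (cases "even (card t)") auto
  then have "(\<Sum>t\<in>Pow s. J_char A t - (-1) ^ card t * J_char A t) = 2 * J_char A s"
    using fin by simp
  then have *: "2 * J_char A s = (\<Sum>r\<in>#A. \<Prod>i\<in>s. 1 + r i) - (\<Sum>r\<in>#A. \<Prod>i\<in>s. 1 - r i)"
    using fin by (simp add: sum_subtractf sum_J_char_Pow sum_signed_J_char_Pow)
  \<comment> \<open>Both values lie in {0, 2}, since \<open>r i\<close> is 1 or -1.\<close>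
  have "even (1 + r i)" "even (1 - r i)" if "r \<in># A" "i \<in> s" for r i
  proof -
    have "\<bar>r i\<bar> = 1" using that s by (blast intro: abs_run[OF design])
    then show "even (1 + r i)" "even (1 - r i)" by (auto simp: abs_if split: if_splits)
  qed
  then have "2 ^ card s dvd 2 * J_char A s"
    unfolding * by (intro dvd_diff[of _ "sum_mset _"] dvd_sum_mset power2_dvd_prod) blast+
  \<comment> \<open>Cancelling the factor 2 in \<open>2 * J_char A s\<close> costs one power of two;
    \<open>card s\<close> is positive because it is odd, so the subtraction does not
    truncate.\<close>
  moreover have "(2::int) ^ card s = 2 * 2 ^ (card s - 1)"
    using odd by (cases "card s") simp_all
  ultimately show ?thesis by simp
qed

lemma power2_min_odd_order_le:
  assumes design: "two_level_design n N A" and nz: "has_nonzero_odd_J n A"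
  shows "2 ^ (min_odd_order n A - 1) \<le> N"
proof -
  let ?P = "\<lambda>q. odd q \<and> (\<exists>s\<subseteq>{1..n}. card s = q \<and> J_char A s \<noteq> 0)"
  have "?P (min_odd_order n A)"
    using nz unfolding min_odd_order_def has_nonzero_odd_J_def by (intro LeastI_ex[of ?P]) auto
  then obtain s where s: "s \<subseteq> {1..n}" "odd (card s)" "card s = min_odd_order n A"
    "J_char A s \<noteq> 0" by auto
  have fin: "finite s" using s(1) by (rule finite_subset) simp
  have "J_char A t = 0" if "t \<subset> s" "odd (card t)" for t
  proof -
    \<comment> \<open>A proper subset of a finite set has smaller cardinality, hence lies below the
      least odd order.\<close>
    have "\<not> ?P (card t)"
      using psubset_card_mono[OF fin that(1)] s(3)
      unfolding min_odd_order_def by (intro not_less_Least) simp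
    with that s(1) show ?thesis by blast
  qed
  then have "2 ^ (card s - 1) dvd J_char A s"
    by (rule power2_dvd_J_char[OF design s(1,2)])
  \<comment> \<open>A nonzero multiple is at least as large in absolute value as its
    divisor.\<close>
  then have "2 ^ (card s - 1) \<le> \<bar>J_char A s\<bar>"
    using dvd_imp_le_int[OF s(4), of "2 ^ (card s - 1)"] by simp
  also have "\<dots> \<le> int N" by (rule abs_J_char_le[OF design s(1)])
  finally have "int (2 ^ (card s - 1)) \<le> int N" by simp
  then show ?thesis unfolding s(3) by (simp only: of_nat_le_iff)
qed

text \<open>Strength 3 excludes the odd orders 1 and 3, the other two vanishing conditions exclude 5
  and 7, and the next odd number is 9.\<close>

lemma min_odd_order_ge_9:
  assumes "has_strength n A 3" "J_vanishes n A 5" "J_vanishes n A 7" "has_nonzero_odd_J n A"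
  shows "9 \<le> min_odd_order n A"
proof -
  let ?P = "\<lambda>q. odd q \<and> (\<exists>s\<subseteq>{1..n}. card s = q \<and> J_char A s \<noteq> 0)"
  have P: "?P (min_odd_order n A)"
    using assms(4) unfolding min_odd_order_def has_nonzero_odd_J_def
    by (intro LeastI_ex[of ?P]) auto
  have "J_vanishes n A 1" "J_vanishes n A 3"
    using assms(1) by (simp_all add: has_strength_def)
  with P assms(2,3) have "min_odd_order n A \<notin> {1, 3, 5, 7}"
    unfolding J_vanishes_def by auto
  with P show ?thesis by (auto elim!: oddE)
qed

theorem corollary6:
  "(\<forall>n N A. two_level_design n N A \<and> has_strength n A 3
       \<and> J_vanishes n A 5 \<and> J_vanishes n A 7 \<and> has_nonzero_odd_J n A
       \<longrightarrow> N \<ge> 2 ^ (min_odd_order n A - 1)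
         \<and> (2::nat) ^ (min_odd_order n A - 1) \<ge> 2 ^ 8 \<and> (2::nat) ^ 8 = 256)
   \<and> (\<forall>N<256. \<forall>n. \<not> (\<exists>A. two_level_design n N A \<and> has_strength n A 3
       \<and> J_vanishes n A 5 \<and> J_vanishes n A 7 \<and> has_nonzero_odd_J n A))"
proof -
  have bounds: "2 ^ (min_odd_order n A - 1) \<le> N" "(2::nat) ^ 8 \<le> 2 ^ (min_odd_order n A - 1)"
    if "two_level_design n N A \<and> has_strength n A 3
       \<and> J_vanishes n A 5 \<and> J_vanishes n A 7 \<and> has_nonzero_odd_J n A" for n N A
  proof -
    show "2 ^ (min_odd_order n A - 1) \<le> N"
      using that by (intro power2_min_odd_order_le) simp_all
    have "9 \<le> min_odd_order n A"
      using that by (intro min_odd_order_ge_9) simp_all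
    then show "(2::nat) ^ 8 \<le> 2 ^ (min_odd_order n A - 1)"
      by (intro power_increasing) simp_all
  qed
  show ?thesis
  proof (intro conjI allI impI notI)
    fix n N A
    assume A: "two_level_design n N A \<and> has_strength n A 3
         \<and> J_vanishes n A 5 \<and> J_vanishes n A 7 \<and> has_nonzero_odd_J n A"
    show "2 ^ (min_odd_order n A - 1) \<le> N"
      and "(2::nat) ^ 8 \<le> 2 ^ (min_odd_order n A - 1)"
      by (rule bounds[OF A])+
    show "(2::nat) ^ 8 = 256" by simp
  next
    fix N :: nat and n
    assume "N < 256" and "\<exists>A. two_level_design n N A \<and> has_strength n A 3
         \<and> J_vanishes n A 5 \<and> J_vanishes n A 7 \<and> has_nonzero_odd_J n A"
    then obtain A where A: "two_level_design n N A \<and> has_strength n A 3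
         \<and> J_vanishes n A 5 \<and> J_vanishes n A 7 \<and> has_nonzero_odd_J n A" by blast
    \<comment> \<open>The two bounds chain through
      \<open>2 ^ (min_odd_order n A - 1)\<close>.\<close>
    have "(2::nat) ^ 8 \<le> N" using bounds[OF A] by (rule order_trans[rotated])
    with \<open>N < 256\<close> show False by simp
  qed
qed

end
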